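(* Let $p \in (0, 1)$ and $a, b \in \mathbb{R}$. For real $n$ with $n > -a/p$ and $n > -b/(1-p)$ let $W_{n} \sim \mathrm{Beta}(pn+a, (1-p)n+b)$. Suppose that one of the following two conditions holds: (i) $p \leq 1/2$ and either $a \geq 1 \geq b$ or $(a+b-2)\left(\frac{a-1}{a+b-2} - p\right) > 0$; (ii) $p \geq 1/2$ and either $b \geq 1 \geq a$ or $(a+b-2)\left(\frac{a-1}{a+b-2} - p\right) < 0$. Then $\mathbb{P}(W_{n} \leq p)$ tends monotonically to $1/2$ as $n$ tends to infinity; that is, $n\mapsto \mathbb{P}(W_n\le p)$ is a monotone function of real $n\in(\max(-a/p,-b/(1-p)),\infty)$ with limit $1/2$ as $n\to\infty$.
   Context: $\mathrm{Beta}(\alpha,\beta)$, for $\alpha,\beta>0$, is the distribution on $(0,1)$ with Lebesgue density $x^{\alpha-1}(1-x)^{\beta-1}/B(\alpha,\beta)$, where $B(\alpha,\beta)=\Gamma(\alpha)\Gamma(\beta)/\Gamma(\alpha+\beta)$. The conditions containing the fraction $(a-1)/(a+b-2)$ are understood to include $a+b\neq 2$. "Monotone" means non-decreasing or non-increasing. *)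

theory Defs
  imports "HOL-Probability.Probability"
begin

definition beta_density :: "real \<Rightarrow> real \<Rightarrow> real \<Rightarrow> real" where
  "beta_density \<alpha> \<beta> x =
     (if 0 < x \<and> x < 1 then x powr (\<alpha> - 1) * (1 - x) powr (\<beta> - 1) / Beta \<alpha> \<beta> else 0)"

end

theory Submission
  imports Defs "HOL-Real_Asymp.Real_Asymp"
begin

text \<open>
  Up to its normalising constant, the density of the law of \<open>W\<^sub>n\<close> is \<open>exp (n * L x) * g x\<close> with
  \<open>L x = p * ln x + (1 - p) * ln (1 - x)\<close> and \<open>g x = x powr (a - 1) * (1 - x) powr (b - 1)\<close>.
  The function \<open>L\<close> increases on \<open>(0, p)\<close> and decreases on \<open>(p, 1)\<close>, so each \<open>x < p\<close> has a twin
  \<open>y > p\<close> with \<open>L y = L x\<close>. Substituting the twin moves the mass on the right of \<open>p\<close> to the left: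
  with \<open>A n\<close> and \<open>B n\<close> the integrals over \<open>(0, p)\<close> and \<open>(p, 1)\<close>, \<open>A n\<close> is the integral of
  \<open>exp (n * L x) * g x\<close> over \<open>(0, p)\<close>, and \<open>B n\<close> that of \<open>exp (n * L x) * g x * \<rho> x\<close>, where the
  weight \<open>\<rho>\<close> does not depend on \<open>n\<close> (\<open>integral_beta_kernel_twin\<close>). Thus \<open>B n / A n\<close> is the mean of
  \<open>\<rho>\<close> under a probability on \<open>(0, p)\<close> that is tilted towards large \<open>L\<close>, that is towards \<open>p\<close>, as
  \<open>n\<close> grows.

  Both claims are now statements about \<open>\<rho>\<close>. If \<open>\<rho>\<close> is decreasing, the tilted mean decreases in \<open>n\<close>
  by Chebyshev's correlation inequality (\<open>exponential_tilt_ratio_mono\<close>). If moreover \<open>\<rho>\<close> tends to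
  \<open>1\<close> at \<open>p\<close>, the mean tends to \<open>1\<close> because the tilted probabilities concentrate at \<open>p\<close>
  (\<open>exponential_tilt_ratio_tendsto\<close>). Then \<open>P (W\<^sub>n \<le> p) = 1 / (1 + B n / A n)\<close> increases to \<open>1 / 2\<close>.

  The limit of \<open>\<rho>\<close> comes from the second order expansion of \<open>L\<close> at its maximum, which makes \<open>x\<close> and
  its twin asymptotically equidistant from \<open>p\<close>. For the monotonicity, put \<open>c = (a - 1) - (a + b - 2) * p\<close>,
  \<open>u = p - x\<close> and \<open>v = y - p\<close>. The derivative of \<open>ln \<rho>\<close> has the opposite sign of
  \<open>c * (1 / u + 1 / v) + p * (1 - p) * (1 / u\<^sup>2 - 1 / v\<^sup>2)\<close>. If \<open>p \<le> 1 / 2\<close>, then \<open>L\<close> falls off faster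
  on the left of \<open>p\<close> than on the right, so \<open>u \<le> v\<close>, and \<open>c \<ge> 0\<close> makes both terms nonnegative.
  The two alternatives of condition (i) both imply \<open>c \<ge> 0\<close>. Condition (ii) becomes condition (i)
  under the reflection \<open>x \<mapsto> 1 - x\<close>, which swaps \<open>a\<close> with \<open>b\<close> and \<open>p\<close> with \<open>1 - p\<close>.
\<close>

section \<open>The exponent of the beta density and its level sets\<close>

definition log_kernel :: "real \<Rightarrow> real \<Rightarrow> real" where
  "log_kernel p x = p * ln x + (1 - p) * ln (1 - x)"

text \<open>
  The inverse of the restriction of \<^term>\<open>log_kernel p\<close> to \<open>(p, 1)\<close>. The twin of a point is split
  into this inverse and \<^term>\<open>log_kernel p\<close> so that it can be differentiated by the inverse function
  theorem and the chain rule.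
\<close>

definition right_level :: "real \<Rightarrow> real \<Rightarrow> real" where
  "right_level p t = (THE y. p < y \<and> y < 1 \<and> log_kernel p y = t)"

definition twin :: "real \<Rightarrow> real \<Rightarrow> real" where
  "twin p x = right_level p (log_kernel p x)"

lemma log_kernel_reflect: "log_kernel (1 - p) (1 - x) = log_kernel p x"
  by (simp add: log_kernel_def)

context
  fixes p :: real
  assumes p: "0 < p" "p < 1"
begin

lemma DERIV_log_kernel:
  assumes "0 < x" "x < 1"
  shows "DERIV (log_kernel p) x :> (p - x) / (x * (1 - x))"
proof -
  have "DERIV (log_kernel p) x :> p * (1 / x) + (1 - p) * (- 1 / (1 - x))"
    unfolding log_kernel_def using assms by (auto intro!: derivative_eq_intros)
  also have "p * (1 / x) + (1 - p) * (- 1 / (1 - x)) = (p - x) / (x * (1 - x))"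
    using assms by (simp add: divide_simps) (simp add: algebra_simps)
  finally show ?thesis .
qed

lemma continuous_on_log_kernel: "S \<subseteq> {0<..<1} \<Longrightarrow> continuous_on S (log_kernel p)"
  by (intro continuous_at_imp_continuous_on ballI DERIV_isCont[OF DERIV_log_kernel]) auto

lemma log_kernel_less_left:
  assumes "0 < x" "x < y" "y \<le> p"
  shows "log_kernel p x < log_kernel p y"
proof (rule DERIV_pos_imp_increasing_open[OF assms(2)])
  fix z assume "x < z" "z < y"
  then show "\<exists>d. DERIV (log_kernel p) z :> d \<and> 0 < d"
    using assms p by (intro exI[of _ "(p - z) / (z * (1 - z))"] conjI DERIV_log_kernel) auto
qed (use assms p in \<open>auto intro!: continuous_on_log_kernel\<close>)

lemma log_kernel_less_right:
  assumes "p \<le> x" "x < y" "y < 1"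
  shows "log_kernel p y < log_kernel p x"
proof (rule DERIV_neg_imp_decreasing_open[OF assms(2)])
  fix z assume "x < z" "z < y"
  then show "\<exists>d. DERIV (log_kernel p) z :> d \<and> d < 0"
    using assms p
    by (intro exI[of _ "(p - z) / (z * (1 - z))"] conjI DERIV_log_kernel) (auto intro!: divide_neg_pos)
qed (use assms p in \<open>auto intro!: continuous_on_log_kernel\<close>)

lemma log_kernel_less_max:
  assumes "0 < x" "x < 1" "x \<noteq> p"
  shows "log_kernel p x < log_kernel p p"
  using log_kernel_less_left[of x p] log_kernel_less_right[of p x] assms by fastforce

text \<open>
  By the intermediate value theorem it is enough to find a point right of \<open>p\<close> whose value is at most
  \<open>t = log_kernel p x\<close>. The point \<open>y0\<close> at which the second summand \<open>(1 - p) * ln (1 - y0)\<close> alone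
  equals \<open>t\<close> will do, since the other summand is negative.
\<close>

lemma ex_right_level:
  assumes "0 < x" "x < 1" "x \<noteq> p"
  shows "\<exists>y. p < y \<and> y < 1 \<and> log_kernel p y = log_kernel p x"
proof -
  define t where "t = log_kernel p x"
  define y0 where "y0 = 1 - exp (t / (1 - p))"
  have t: "t < log_kernel p p" unfolding t_def by (rule log_kernel_less_max[OF assms])
  also have "\<dots> \<le> (1 - p) * ln (1 - p)" using p by (simp add: log_kernel_def mult_nonneg_nonpos)
  finally have "t / (1 - p) < ln (1 - p)" using p by (simp add: field_simps)
  then have "exp (t / (1 - p)) < 1 - p" using p by (metis exp_less_mono exp_ln diff_gt_0_iff_gt)
  then have y0: "p < y0" "y0 < 1" by (auto simp: y0_def)
  have "log_kernel p y0 = p * ln y0 + t" using p by (simp add: log_kernel_def y0_def)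
  also have "\<dots> \<le> t" using p y0 by (simp add: mult_nonneg_nonpos)
  finally have "\<exists>y. p \<le> y \<and> y \<le> y0 \<and> log_kernel p y = t"
    using t y0 p by (intro IVT2' continuous_on_log_kernel) auto
  then obtain y where "p \<le> y" "y \<le> y0" "log_kernel p y = t" by auto
  with t y0 show ?thesis by (intro exI[of _ y]) (auto simp: t_def le_less)
qed

lemma right_level_log_kernel:
  assumes "p < y" "y < 1"
  shows "right_level p (log_kernel p y) = y"
  unfolding right_level_def
proof (rule the_equality)
  fix z assume z: "p < z \<and> z < 1 \<and> log_kernel p z = log_kernel p y"
  then show "z = y"
    using assms log_kernel_less_right[of y z] log_kernel_less_right[of z y]
    by (cases z y rule: linorder_cases) auto
qed (use assms in auto)

lemma twin:
  assumes "0 < x" "x < p"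
  shows "p < twin p x" "twin p x < 1" "log_kernel p (twin p x) = log_kernel p x"
proof -
  obtain y where y: "p < y" "y < 1" "log_kernel p y = log_kernel p x"
    using ex_right_level[of x] assms p by auto
  then have "twin p x = y"
    using right_level_log_kernel[of y] by (simp add: twin_def)
  with y show "p < twin p x" "twin p x < 1" "log_kernel p (twin p x) = log_kernel p x" by auto
qed

lemma twin_eqI:
  assumes "p < y" "y < 1" "log_kernel p y = log_kernel p x"
  shows "twin p x = y"
  using right_level_log_kernel[OF assms(1,2)] assms(3) by (simp add: twin_def)

lemma inj_on_twin: "inj_on (twin p) {0<..<p}"
proof (rule inj_onI)
  fix x y assume *: "x \<in> {0<..<p}" "y \<in> {0<..<p}" "twin p x = twin p y"
  then have "log_kernel p x = log_kernel p y" by (metis greaterThanLessThan_iff twin(3))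
  then show "x = y" using log_kernel_less_left[of x y] log_kernel_less_left[of y x] * by fastforce
qed

end

text \<open>
  Surjectivity is the existence of a point with the same value on the other side of \<open>p\<close>, which is
  \<open>ex_right_level\<close> for the reflected function.
\<close>

lemma twin_image:
  assumes p: "0 < p" "p < 1"
  shows "twin p ` {0<..<p} = {p<..<1}"
proof (intro equalityI subsetI)
  fix y assume y: "y \<in> {p<..<1}"
  obtain z where z: "1 - p < z" "z < 1" "log_kernel (1 - p) z = log_kernel (1 - p) (1 - y)"
    using ex_right_level[of "1 - p" "1 - y"] p y by auto
  then have "log_kernel p y = log_kernel p (1 - z)"
    using log_kernel_reflect[of p "1 - z"] log_kernel_reflect[of p y] by simp
  then show "y \<in> twin p ` {0<..<p}"
    using z y by (intro rev_image_eqI[of "1 - z"] twin_eqI[symmetric] p) auto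
qed (use twin[OF p] in auto)

context
  fixes p :: real
  assumes p: "0 < p" "p < 1"
begin

lemma DERIV_twin:
  assumes x: "0 < x" "x < p"
  shows "DERIV (twin p) x :>
    ((p - x) / (x * (1 - x))) / ((p - twin p x) / (twin p x * (1 - twin p x)))"
proof -
  let ?y = "twin p x"
  let ?D = "(p - ?y) / (?y * (1 - ?y))"
  note y = twin[OF p x]
  have "?D \<noteq> 0" using y p by auto
  have "(right_level p has_derivative (\<lambda>t. t / ?D)) (at (log_kernel p ?y))"
  proof (rule has_derivative_inverse_strong[where f = "log_kernel p" and x = ?y and S = "{p<..<1}"])
    show "(log_kernel p has_derivative (\<lambda>t. ?D * t)) (at ?y)"
      using DERIV_log_kernel[OF p, of ?y] y p unfolding has_field_derivative_def by fastforce
    show "(\<lambda>t. ?D * t) \<circ> (\<lambda>t. t / ?D) = id" using \<open>?D \<noteq> 0\<close> by (intro ext) simp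
  qed (use y p in \<open>auto intro!: continuous_on_log_kernel right_level_log_kernel\<close>)
  then have "DERIV (right_level p) (log_kernel p x) :> 1 / ?D"
    using y by (auto simp: has_field_derivative_def fun_eq_iff elim!: has_derivative_eq_rhs)
  from DERIV_chain2[OF this DERIV_log_kernel[OF p, of x]]
  have "DERIV (twin p) x :> 1 / ?D * ((p - x) / (x * (1 - x)))"
    using x p unfolding twin_def[abs_def] by simp
  then show ?thesis by (rule DERIV_cong) (simp add: mult_ac)
qed

text \<open>
  The derivatives of \<^term>\<open>log_kernel p\<close> at \<open>p + u\<close> and \<open>p - u\<close> are \<open>- u\<close> and \<open>u\<close> divided by the value
  of \<open>z * (1 - z)\<close> there. As \<open>p \<le> 1 / 2\<close>, the point \<open>p + u\<close> is at least as close to \<open>1 / 2\<close> as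
  \<open>p - u\<close>, so the function falls more slowly on the right and reaches a given level later.
\<close>

lemma twin_offset_ge:
  assumes half: "p \<le> 1/2" and x: "0 < x" "x < p"
  shows "p - x \<le> twin p x - p"
proof -
  let ?d = "\<lambda>u. log_kernel p (p - u) - log_kernel p (p + u)"
  have "?d (p - x) \<le> ?d 0"
  proof (rule DERIV_nonpos_imp_nonincreasing[where f = ?d])
    fix u assume u: "0 \<le> u" "u \<le> p - x"
    let ?D = "(p - (p - u)) / ((p - u) * (1 - (p - u))) * (0 - 1) - (p - (p + u)) / ((p + u) * (1 - (p + u))) * (0 + 1)"
    have "DERIV ?d u :> ?D"
      by (intro DERIV_diff DERIV_chain2[OF DERIV_log_kernel] DERIV_add DERIV_const DERIV_ident)
        (use u x p half in auto)
    moreover have "u / ((p + u) * (1 - (p + u))) \<le> u / ((p - u) * (1 - (p - u)))"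
    proof (rule divide_left_mono)
      have "0 \<le> u * (1 - 2 * p)" using u half by simp
      then show "(p - u) * (1 - (p - u)) \<le> (p + u) * (1 - (p + u))" by (simp add: algebra_simps)
    qed (use u x p half in auto)
    then have "?D \<le> 0" by simp
    ultimately show "\<exists>y. DERIV ?d u :> y \<and> y \<le> 0" by blast
  qed (use x in auto)
  then have "log_kernel p (twin p x) \<le> log_kernel p (p + (p - x))"
    using twin[OF p x] by simp
  then show ?thesis using log_kernel_less_right[OF p, of "twin p x" "p + (p - x)"] twin[OF p x] half x
    by fastforce
qed

lemma twin_tendsto: "(twin p \<longlongrightarrow> p) (at_left p)"
proof (rule tendstoI)
  fix e :: real assume "e > 0"
  define y where "y = min (p + e) ((p + 1) / 2)"
  have y: "p < y" "y \<le> p + e" "y < 1" using \<open>e > 0\<close> p by (auto simp: y_def min_less_iff_disj)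
  have "(log_kernel p \<longlongrightarrow> log_kernel p p) (at_left p)"
    using DERIV_isCont[OF DERIV_log_kernel[OF p p]] by (auto simp: isCont_def intro: tendsto_mono at_le)
  then have "\<forall>\<^sub>F x in at_left p. log_kernel p y < log_kernel p x"
    using y log_kernel_less_right[OF p, of p y] by (auto dest: order_tendstoD)
  moreover have "\<forall>\<^sub>F x in at_left p. x \<in> {0<..<p}" using p eventually_at_left_real[of 0 p] by simp
  ultimately show "\<forall>\<^sub>F x in at_left p. dist (twin p x) p < e"
  proof eventually_elim
    case (elim x)
    then have x: "0 < x" "x < p" by auto
    have "twin p x < y"
      using log_kernel_less_right[OF p, of y "twin p x"] twin[OF p x] elim y
      by (cases y "twin p x" rule: linorder_cases) auto
    then show ?case using y twin[OF p x] by (auto simp: dist_real_def)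
  qed
qed

text \<open>
  This is one half of the negated second derivative at the maximum. Its use is that both sides of
  \<open>p\<close> have the same curvature.
\<close>

lemma log_kernel_quadratic:
  "((\<lambda>x. (log_kernel p p - log_kernel p x) / (x - p)\<^sup>2) \<longlongrightarrow> 1 / (2 * p * (1 - p))) (at p)"
proof (rule lhopital)
  have ev: "\<forall>\<^sub>F x in at p. x \<in> {0<..<1} - {p}"
    using p by (intro eventually_at_in_open) auto
  show "((\<lambda>x. log_kernel p p - log_kernel p x) \<longlongrightarrow> 0) (at p)"
    using DERIV_isCont[OF DERIV_log_kernel[OF p p]] by (auto simp: isCont_def intro!: tendsto_eq_intros)
  show "((\<lambda>x. (x - p)\<^sup>2) \<longlongrightarrow> 0) (at p)" by (auto intro!: tendsto_eq_intros)
  show "\<forall>\<^sub>F x in at p. (x - p)\<^sup>2 \<noteq> 0" "\<forall>\<^sub>F x in at p. 2 * (x - p) \<noteq> 0"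
    using ev by (auto elim!: eventually_mono)
  show "\<forall>\<^sub>F x in at p. DERIV (\<lambda>x. log_kernel p p - log_kernel p x) x :> 0 - (p - x) / (x * (1 - x))"
    using ev by eventually_elim (intro DERIV_diff DERIV_const DERIV_log_kernel p, auto)
  show "\<forall>\<^sub>F x in at p. DERIV (\<lambda>x. (x - p)\<^sup>2) x :> 2 * (x - p)"
    by (intro always_eventually allI) (auto intro!: derivative_eq_intros)
  have "((\<lambda>x. 1 / (2 * x * (1 - x))) \<longlongrightarrow> 1 / (2 * p * (1 - p))) (at p)"
    using p by (intro tendsto_intros) auto
  moreover have "\<forall>\<^sub>F x in at p. 1 / (2 * x * (1 - x)) = (0 - (p - x) / (x * (1 - x))) / (2 * (x - p))"
    using ev
  proof eventually_elim
    case (elim x)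
    then have "x \<noteq> 0" "1 - x \<noteq> 0" "x - p \<noteq> 0" by auto
    then show ?case by (simp add: divide_simps) algebra
  qed
  ultimately show "((\<lambda>x. (0 - (p - x) / (x * (1 - x))) / (2 * (x - p))) \<longlongrightarrow> 1 / (2 * p * (1 - p))) (at p)"
    by (rule Lim_transform_eventually)
qed

lemma twin_offset_ratio:
  "((\<lambda>x. (twin p x - p)\<^sup>2 / (x - p)\<^sup>2) \<longlongrightarrow> 1) (at_left p)"
proof -
  let ?Q = "\<lambda>x. (log_kernel p p - log_kernel p x) / (x - p)\<^sup>2"
  let ?c = "1 / (2 * p * (1 - p))"
  have ev: "\<forall>\<^sub>F x in at_left p. x \<in> {0<..<p}" using p eventually_at_left_real[of 0 p] by simp
  have 1: "(?Q \<longlongrightarrow> ?c) (at_left p)"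
    by (rule tendsto_mono[OF at_le log_kernel_quadratic]) auto
  have "\<forall>\<^sub>F x in at_left p. twin p x \<noteq> p" using ev by eventually_elim (use twin[OF p] in force)
  then have "filterlim (twin p) (at p) (at_left p)"
    using twin_tendsto by (simp add: filterlim_at)
  from filterlim_compose[OF log_kernel_quadratic this]
  have "((\<lambda>x. ?Q (twin p x)) \<longlongrightarrow> ?c) (at_left p)" .
  from tendsto_divide[OF 1 this]
  have "((\<lambda>x. ?Q x / ?Q (twin p x)) \<longlongrightarrow> 1) (at_left p)" using p by simp
  moreover have "\<forall>\<^sub>F x in at_left p. ?Q x / ?Q (twin p x) = (twin p x - p)\<^sup>2 / (x - p)\<^sup>2"
    using ev
  proof eventually_elim
    case (elim x)
    then have "log_kernel p x < log_kernel p p" using p log_kernel_less_max[OF p, of x] by auto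
    then show ?case using elim twin[OF p, of x] by (auto simp: divide_simps)
  qed
  ultimately show ?thesis by (rule Lim_transform_eventually)
qed

end

section \<open>The weight that compares the two sides\<close>

text \<open>
  The logarithm of \<open>g x / \<bar>(log_kernel p)' x\<bar>\<close> with \<open>g x = x powr (a - 1) * (1 - x) powr (b - 1)\<close>: the
  density, with respect to the value \<open>t\<close> of \<^term>\<open>log_kernel p\<close>, of the mass that \<open>g\<close> carries near
  level \<open>t\<close> on one side of \<open>p\<close>. The squared distance keeps one formula for both sides.
\<close>

definition log_flux :: "real \<Rightarrow> real \<Rightarrow> real \<Rightarrow> real \<Rightarrow> real" where
  "log_flux p a b x = a * ln x + b * ln (1 - x) - ln ((x - p)\<^sup>2) / 2"

text \<open>
  The weight \<open>\<rho>\<close> of the introduction: the mass near the twin, in the right half, per unit of mass near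
  \<open>x\<close>, in the left half.
\<close>

definition twin_ratio :: "real \<Rightarrow> real \<Rightarrow> real \<Rightarrow> real \<Rightarrow> real" where
  "twin_ratio p a b x = exp (log_flux p a b (twin p x) - log_flux p a b x)"

context
  fixes p a b :: real
  assumes p: "0 < p" "p < 1"
begin

text \<open>
  The last factor is the derivative of \<^term>\<open>log_kernel p\<close>, so the first factor is the derivative of
  \<^term>\<open>log_flux p a b\<close> with respect to the level. In this form it depends on \<open>x\<close> only
  through \<open>x - p\<close>, and \<open>a\<close> and \<open>b\<close> enter the part that varies with \<open>x\<close> only through
  \<open>(a - 1) - (a + b - 2) * p\<close>.
\<close>

lemma DERIV_log_flux:
  assumes "0 < x" "x < 1" "x \<noteq> p"
  shows "DERIV (log_flux p a b) x :>
    (a + b - 1 - ((a - 1) - (a + b - 2) * p) / (x - p) + p * (1 - p) / (x - p)\<^sup>2) * ((p - x) / (x * (1 - x)))"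
proof -
  have *: "(x - p)\<^sup>2 > 0" using assms by simp
  have "DERIV (log_flux p a b) x :> a * (1 / x) + b * (- 1 / (1 - x)) - (2 * (x - p)) / (x - p)\<^sup>2 / 2"
    unfolding log_flux_def using assms * by (auto intro!: derivative_eq_intros simp: divide_simps)
  also have "a * (1 / x) + b * (- 1 / (1 - x)) - (2 * (x - p)) / (x - p)\<^sup>2 / 2 =
    (a + b - 1 - ((a - 1) - (a + b - 2) * p) / (x - p) + p * (1 - p) / (x - p)\<^sup>2) * ((p - x) / (x * (1 - x)))"
    using assms by (simp add: divide_simps power2_eq_square) (simp add: algebra_simps)
  finally show ?thesis .
qed

text \<open>
  A point and its twin are at the same level, so the sign of the derivative of \<^term>\<open>twin_ratio p a b\<close>
  is that of the difference \<open>K v - K (- u)\<close> of the level derivatives \<open>K\<close> of \<^term>\<open>log_flux p a b\<close> at the two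
  points. Both the \<open>1 / s\<close> and the \<open>1 / s\<^sup>2\<close> part of \<open>K s\<close> contribute to it with the same sign,
  the latter because the twin is the more distant of the two points.
\<close>

lemma twin_ratio_antimono:
  assumes half: "p \<le> 1/2" and c: "0 \<le> (a - 1) - (a + b - 2) * p"
    and xy: "0 < x" "x \<le> y" "y < p"
  shows "twin_ratio p a b y \<le> twin_ratio p a b x"
proof -
  have "log_flux p a b (twin p y) - log_flux p a b y \<le> log_flux p a b (twin p x) - log_flux p a b x"
  proof (rule DERIV_nonpos_imp_nonincreasing[OF xy(2)])
    fix z assume "x \<le> z" "z \<le> y"
    then have z: "0 < z" "z < p" using xy by auto
    note m = twin[OF p z]
    define u where "u = p - z"
    define v where "v = twin p z - p"
    define c where "c = (a - 1) - (a + b - 2) * p"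
    define K where "K s = a + b - 1 - c / s + p * (1 - p) / s\<^sup>2" for s
    define l where "l s = (p - s) / (s * (1 - s))" for s
    have l: "l z > 0" "l (twin p z) \<noteq> 0" using z m p by (auto simp: l_def)
    have uv: "0 < u" "u \<le> v" "0 < v"
      using z m twin_offset_ge[OF p half z] by (auto simp: u_def v_def)
    have "DERIV (\<lambda>x. log_flux p a b (twin p x) - log_flux p a b x) z :>
      (K (twin p z - p) * l (twin p z)) * (l z / l (twin p z)) - K (z - p) * l z"
      unfolding K_def l_def c_def
      by (intro DERIV_diff DERIV_chain2[OF DERIV_log_flux] DERIV_twin DERIV_log_flux p)
        (use z m p in auto)
    also have "(K (twin p z - p) * l (twin p z)) * (l z / l (twin p z)) - K (z - p) * l z
      = (K v - K (- u)) * l z" using l by (simp add: u_def v_def field_simps)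
    finally have D: "DERIV (\<lambda>x. log_flux p a b (twin p x) - log_flux p a b x) z :> (K v - K (- u)) * l z" .
    have "c / v \<ge> 0" "c / u \<ge> 0" using \<open>0 \<le> _\<close> uv by (auto simp: c_def)
    moreover have "p * (1 - p) / v\<^sup>2 \<le> p * (1 - p) / u\<^sup>2"
      using uv p by (intro divide_left_mono power_mono) auto
    ultimately have "K v - K (- u) \<le> 0" by (simp add: K_def)
    with l have "(K v - K (- u)) * l z \<le> 0" by (simp add: mult_nonpos_nonneg)
    with D show "\<exists>d. DERIV (\<lambda>x. log_flux p a b (twin p x) - log_flux p a b x) z :> d \<and> d \<le> 0" by blast
  qed
  then show ?thesis by (simp add: twin_ratio_def)
qed

lemma twin_ratio_tendsto: "(twin_ratio p a b \<longlongrightarrow> 1) (at_left p)"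
proof -
  let ?y = "twin p"
  have "((\<lambda>x. exp (a * (ln (?y x) - ln x) + b * (ln (1 - ?y x) - ln (1 - x)) - ln ((?y x - p)\<^sup>2 / (x - p)\<^sup>2) / 2))
    \<longlongrightarrow> exp (a * (ln p - ln p) + b * (ln (1 - p) - ln (1 - p)) - ln 1 / 2)) (at_left p)"
    using p by (intro tendsto_intros twin_tendsto twin_offset_ratio) auto
  moreover have "\<forall>\<^sub>F x in at_left p. x \<in> {0<..<p}" using p eventually_at_left_real[of 0 p] by simp
  then have "\<forall>\<^sub>F x in at_left p. exp (a * (ln (?y x) - ln x) + b * (ln (1 - ?y x) - ln (1 - x)) - ln ((?y x - p)\<^sup>2 / (x - p)\<^sup>2) / 2)
    = twin_ratio p a b x"
    by eventually_elim
      (use twin[OF p] in \<open>force simp: twin_ratio_def log_flux_def ln_div algebra_simps add_divide_distrib diff_divide_distrib\<close>)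
  ultimately show ?thesis by (auto dest: Lim_transform_eventually)
qed

end

section \<open>Means under exponential tilting\<close>

text \<open>
  Chebyshev's correlation inequality: \<open>exp ((m - n) * l x)\<close> and \<open>\<rho> x\<close> are oppositely ordered, so
  \<open>(exp ((m - n) * l x) - exp ((m - n) * l y)) * (\<rho> y - \<rho> x)\<close> is nonnegative for all \<open>x\<close> and \<open>y\<close>.
  Integrating it first in \<open>x\<close> and then in \<open>y\<close> against the tilt \<open>n\<close> gives twice the claim. All four terms
  are products of a function of \<open>x\<close> and one of \<open>y\<close>, so linearity alone evaluates the iterated
  integral.
\<close>

lemma exponential_tilt_ratio_mono:
  fixes l g \<rho> :: "'s \<Rightarrow> real"
  assumes "n \<le> m"
    and A: "\<And>k. k \<in> {n, m} \<Longrightarrow> integrable N (\<lambda>x. exp (k * l x) * g x)"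
    and B: "\<And>k. k \<in> {n, m} \<Longrightarrow> integrable N (\<lambda>x. exp (k * l x) * g x * \<rho> x)"
    and g: "\<And>x. x \<in> space N \<Longrightarrow> 0 \<le> g x"
    and \<rho>: "\<And>x y. x \<in> space N \<Longrightarrow> y \<in> space N \<Longrightarrow> l x \<le> l y \<Longrightarrow> \<rho> y \<le> \<rho> x"
  shows "(\<integral>x. exp (n * l x) * g x \<partial>N) * (\<integral>x. exp (m * l x) * g x * \<rho> x \<partial>N)
    \<le> (\<integral>x. exp (m * l x) * g x \<partial>N) * (\<integral>x. exp (n * l x) * g x * \<rho> x \<partial>N)"
proof -
  define f where "f k x = exp (k * l x) * g x" for k x
  define E where "E k = (\<integral>x. f k x \<partial>N)" for k
  define R where "R k = (\<integral>x. f k x * \<rho> x \<partial>N)" for k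
  note [simp] = A[folded f_def] B[folded f_def]
  have f_m: "f m x = exp ((m - n) * l x) * f n x" for x
    by (simp add: f_def mult_exp_exp ring_distribs flip: mult.assoc)
  have f_nonneg: "0 \<le> f n x" if "x \<in> space N" for x using g[OF that] by (simp add: f_def)
  have inner: "0 \<le> E m * \<rho> y - R m - exp ((m - n) * l y) * \<rho> y * E n + exp ((m - n) * l y) * R n"
    if y: "y \<in> space N" for y
  proof -
    let ?e = "\<lambda>x. exp ((m - n) * l x)"
    have "0 \<le> (\<integral>x. (?e x - ?e y) * (\<rho> y - \<rho> x) * f n x \<partial>N)"
    proof (rule Bochner_Integration.integral_nonneg)
      fix x assume x: "x \<in> space N"
      have "0 \<le> (?e x - ?e y) * (\<rho> y - \<rho> x)"
      proof (cases "l x \<le> l y")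
        case True
        then show ?thesis using \<rho>[OF x y] \<open>n \<le> m\<close> by (intro mult_nonpos_nonpos) (auto intro: mult_left_mono)
      next
        case False
        then show ?thesis using \<rho>[OF y x] \<open>n \<le> m\<close> by (intro mult_nonneg_nonneg) (auto intro: mult_left_mono)
      qed
      then show "0 \<le> (?e x - ?e y) * (\<rho> y - \<rho> x) * f n x" using f_nonneg[OF x] by simp
    qed
    also have "(\<lambda>x. (?e x - ?e y) * (\<rho> y - \<rho> x) * f n x) =
        (\<lambda>x. f m x * \<rho> y - f m x * \<rho> x - ?e y * \<rho> y * f n x + ?e y * (f n x * \<rho> x))"
      by (simp add: f_m algebra_simps)
    also have "(\<integral>x. \<dots> x \<partial>N) = E m * \<rho> y - R m - ?e y * \<rho> y * E n + ?e y * R n"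
      by (simp add: E_def R_def)
    finally show ?thesis .
  qed
  have "0 \<le> (\<integral>y. (E m * \<rho> y - R m - exp ((m - n) * l y) * \<rho> y * E n + exp ((m - n) * l y) * R n) * f n y \<partial>N)"
    using inner f_nonneg by (intro Bochner_Integration.integral_nonneg) simp
  also have "(\<lambda>y. (E m * \<rho> y - R m - exp ((m - n) * l y) * \<rho> y * E n + exp ((m - n) * l y) * R n) * f n y) =
      (\<lambda>y. E m * (f n y * \<rho> y) - R m * f n y - E n * (f m y * \<rho> y) + R n * f m y)"
    by (simp add: f_m algebra_simps)
  also have "(\<integral>y. \<dots> y \<partial>N) = E m * R n - R m * E n - E n * R m + R n * E m"
    by (simp add: E_def R_def)
  finally show ?thesis by (simp add: E_def R_def f_def algebra_simps)
qed

lemma integral_indicator_pos: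
  fixes f :: "'s \<Rightarrow> real"
  assumes f: "integrable N f" and pos: "\<And>x. x \<in> space N \<Longrightarrow> 0 < f x"
    and S: "S \<in> sets N" "0 < emeasure N S"
  shows "0 < (\<integral>x. indicator S x * f x \<partial>N)"
proof -
  have int: "integrable N (\<lambda>x. indicator S x * f x)"
    using integrable_mult_indicator[OF S(1) f] by simp
  have nn: "0 \<le> indicator S x * f x" if "x \<in> space N" for x
    using pos[OF that] by simp
  have "(\<integral>x. indicator S x * f x \<partial>N) \<noteq> 0"
  proof
    assume "(\<integral>x. indicator S x * f x \<partial>N) = 0"
    then have "AE x in N. indicator S x * f x = 0"
      using integral_nonneg_eq_0_iff_AE[OF int] nn by (simp add: AE_I2)
    then have "AE x in N. x \<notin> S"
      using AE_space by eventually_elim (use pos in \<open>force simp: indicator_def\<close>)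
    then have "emeasure N S = 0"
      using S(1) sets.sets_into_space[OF S(1)] by (subst (asm) AE_iff_measurable[OF S(1)]) auto
    with S(2) show False by simp
  qed
  moreover have "0 \<le> (\<integral>x. indicator S x * f x \<partial>N)"
    by (rule Bochner_Integration.integral_nonneg) (rule nn)
  ultimately show ?thesis by simp
qed

text \<open>
  On \<open>l > s\<close> the weight \<open>\<rho>\<close> is at most \<open>1 + e\<close>. The part of the tilted integral over \<open>l \<le> s\<close> grows
  at most like \<open>exp (n * s)\<close>, whereas the set \<open>l \<ge> t\<close>, which has positive measure, makes the denominator
  grow at least like \<open>exp (n * t)\<close>. As \<open>s < t\<close>, the ratio of that part to the
  denominator vanishes in the limit.
\<close>

lemma exponential_tilt_ratio_tendsto:
  fixes l g \<rho> :: "'s \<Rightarrow> real"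
  assumes A: "\<And>n. n > n0 \<Longrightarrow> integrable N (\<lambda>x. exp (n * l x) * g x)"
    and B: "\<And>n. n > n0 \<Longrightarrow> integrable N (\<lambda>x. exp (n * l x) * g x * \<rho> x)"
    and l: "l \<in> borel_measurable N"
    and g: "\<And>x. x \<in> space N \<Longrightarrow> 0 < g x"
    and \<rho>: "\<And>x. x \<in> space N \<Longrightarrow> 1 \<le> \<rho> x"
    and conc: "\<And>e. 0 < e \<Longrightarrow> \<exists>s t. s < t \<and> (\<forall>x\<in>space N. s < l x \<longrightarrow> \<rho> x \<le> 1 + e) \<and>
       0 < emeasure N {x \<in> space N. t \<le> l x}"
  shows "((\<lambda>n. (\<integral>x. exp (n * l x) * g x * \<rho> x \<partial>N) / (\<integral>x. exp (n * l x) * g x \<partial>N)) \<longlongrightarrow> 1) at_top"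
proof -
  define f where "f k x = exp (k * l x) * g x" for k x
  define E where "E k = (\<integral>x. f k x \<partial>N)" for k
  define R where "R k = (\<integral>x. f k x * \<rho> x \<partial>N)" for k
  define D where "D k t = (\<integral>x. indicator {x \<in> space N. t \<le> l x} x * f k x \<partial>N)" for k t
  note int [simp] = A[folded f_def] B[folded f_def]
  have f_pos: "0 < f k x" if "x \<in> space N" for k x using g[OF that] by (simp add: f_def)
  have set [measurable]: "{x \<in> space N. t \<le> l x} \<in> sets N" for t using l by measurable
  have intD: "integrable N (\<lambda>x. indicator {x \<in> space N. t \<le> l x} x * f k x)" if "k > n0" for k t
    using integrable_mult_indicator[OF set int(1)[OF that]] by simp
  have D_pos: "0 < D k t" if "k > n0" "0 < emeasure N {x \<in> space N. t \<le> l x}" for k t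
    unfolding D_def using that f_pos by (intro integral_indicator_pos) auto
  have D_le: "exp ((n - k) * t) * D k t \<le> E n" if "n0 < k" "k \<le> n" for n k t
  proof -
    have "exp ((n - k) * t) * D k t = (\<integral>x. exp ((n - k) * t) * (indicator {x \<in> space N. t \<le> l x} x * f k x) \<partial>N)"
      by (simp add: D_def)
    also have "\<dots> \<le> E n" unfolding E_def
    proof (rule integral_mono)
      fix x assume x: "x \<in> space N"
      have "exp ((n - k) * t) * f k x \<le> exp ((n - k) * l x) * f k x" if "t \<le> l x"
        using that \<open>k \<le> n\<close> f_pos[OF x, of k] by (intro mult_right_mono) (auto intro: mult_left_mono)
      also have "exp ((n - k) * l x) * f k x = f n x"
        by (simp add: f_def mult_exp_exp ring_distribs flip: mult.assoc)
      finally show "exp ((n - k) * t) * (indicator {x \<in> space N. t \<le> l x} x * f k x) \<le> f n x"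
        using f_pos[OF x, of n] by (simp add: indicator_def)
    qed (use that intD in auto)
    finally show ?thesis .
  qed
  have E_pos: "0 < E n" if "n > n0" for n
  proof -
    obtain t where "0 < emeasure N {x \<in> space N. t \<le> l x}" using conc[of 1] by auto
    from D_pos[OF that this] D_le[OF that order_refl, of t] show ?thesis by simp
  qed
  have "((\<lambda>n. R n / E n) \<longlongrightarrow> 1) at_top"
  proof (rule tendstoI)
    fix e :: real assume "0 < e"
    obtain s t where st: "s < t" "\<And>x. x \<in> space N \<Longrightarrow> s < l x \<Longrightarrow> \<rho> x \<le> 1 + e / 2"
      "0 < emeasure N {x \<in> space N. t \<le> l x}" using conc[of "e / 2"] \<open>0 < e\<close> by auto
    \<comment> \<open>Any \<open>k > n0\<close> serves as the fixed tilt relative to which the growth in \<open>n\<close> is measured.\<close>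
    define k where "k = n0 + 1"
    define C where "C = R k / D k t"
    have Dk: "0 < D k t" using D_pos st by (simp add: k_def)
    have "((\<lambda>n. exp ((n - k) * (s - t)) * C) \<longlongrightarrow> 0 * C) at_top"
    proof (intro tendsto_mult_right filterlim_compose[OF exp_at_bot])
      show "LIM n at_top. (n - k) * (s - t) :> at_bot" using st(1) by real_asymp
    qed
    then have "\<forall>\<^sub>F n in at_top. exp ((n - k) * (s - t)) * C < e / 2"
      using \<open>0 < e\<close> by (intro order_tendstoD(2)[of _ "0 * C"]) auto
    with eventually_ge_at_top[of k] show "\<forall>\<^sub>F n in at_top. dist (R n / E n) 1 < e"
    proof eventually_elim
      case (elim n)
      then have n: "n0 < n" by (simp add: k_def)
      have En: "0 < E n" by (rule E_pos[OF n])
      have "E n \<le> R n" (is ?lower) unfolding E_def R_def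
        using n f_pos[of _ n] \<rho> by (intro integral_mono) auto
      have "R n \<le> (\<integral>x. (1 + e / 2) * f n x + exp ((n - k) * s) * (f k x * \<rho> x) \<partial>N)" unfolding R_def
      proof (rule integral_mono)
        fix x assume x: "x \<in> space N"
        show "f n x * \<rho> x \<le> (1 + e / 2) * f n x + exp ((n - k) * s) * (f k x * \<rho> x)"
        proof (cases "s < l x")
          case True
          then have "f n x * \<rho> x \<le> f n x * (1 + e / 2)" using st(2)[OF x] f_pos[OF x, of n] by simp
          moreover have "0 \<le> exp ((n - k) * s) * (f k x * \<rho> x)"
            using f_pos[OF x, of k] \<rho>[OF x] by simp
          ultimately show ?thesis by (simp add: mult.commute)
        next
          case False
          have "f n x = exp ((n - k) * l x) * f k x"
            by (simp add: f_def mult_exp_exp ring_distribs flip: mult.assoc)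
          also have "\<dots> \<le> exp ((n - k) * s) * f k x"
            using False elim f_pos[OF x, of k] by (intro mult_right_mono) (auto intro: mult_left_mono)
          finally have "f n x * \<rho> x \<le> exp ((n - k) * s) * f k x * \<rho> x"
            using \<rho>[OF x] by (intro mult_right_mono) auto
          moreover have "0 \<le> (1 + e / 2) * f n x" using f_pos[OF x, of n] \<open>0 < e\<close> by simp
          ultimately show ?thesis by (simp add: mult.assoc)
        qed
      qed (use n in \<open>auto simp: k_def\<close>)
      also have "\<dots> = (1 + e / 2) * E n + exp ((n - k) * s) * R k"
        using n by (simp add: E_def R_def k_def)
      finally have "R n / E n \<le> 1 + e / 2 + exp ((n - k) * s) * R k / E n"
        using En by (simp add: field_simps)
      moreover have "exp ((n - k) * s) * R k / E n \<le> exp ((n - k) * (s - t)) * C"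
      proof -
        have "0 \<le> R k" unfolding R_def
          using f_pos[of _ k] \<rho> by (intro Bochner_Integration.integral_nonneg) fastforce
        then have "exp ((n - k) * s) * R k / E n \<le> exp ((n - k) * s) * R k / (exp ((n - k) * t) * D k t)"
          using D_le[of k n t] elim Dk En by (intro divide_left_mono) (auto simp: k_def)
        also have "\<dots> = exp ((n - k) * (s - t)) * C"
          using Dk by (simp add: C_def right_diff_distrib exp_diff)
        finally show ?thesis .
      qed
      ultimately have "1 \<le> R n / E n" "R n / E n < 1 + e" using elim En \<open>?lower\<close> by auto
      then show ?case by (simp add: dist_real_def)
    qed
  qed
  then show "((\<lambda>n. (\<integral>x. exp (n * l x) * g x * \<rho> x \<partial>N) / (\<integral>x. exp (n * l x) * g x \<partial>N)) \<longlongrightarrow> 1) at_top"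
    by (simp add: R_def E_def f_def)
qed

section \<open>The beta distribution function at \<open>p\<close>\<close>

definition beta_kernel :: "real \<Rightarrow> real \<Rightarrow> real \<Rightarrow> real" where
  "beta_kernel \<alpha> \<beta> x = x powr (\<alpha> - 1) * (1 - x) powr (\<beta> - 1)"

definition beta_cdf :: "real \<Rightarrow> real \<Rightarrow> real \<Rightarrow> real" where
  "beta_cdf \<alpha> \<beta> p = integral {0<..<p} (beta_kernel \<alpha> \<beta>) / Beta \<alpha> \<beta>"

lemma beta_kernel_nonneg [simp]: "0 \<le> beta_kernel \<alpha> \<beta> x"
  by (simp add: beta_kernel_def)

lemma beta_kernel_eq_exp:
  assumes "0 < x" "x < 1"
  shows "beta_kernel (p * n + a) ((1 - p) * n + b) x = exp (n * log_kernel p x) * beta_kernel a b x"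
  using assms by (simp add: beta_kernel_def log_kernel_def powr_def mult_exp_exp algebra_simps)

lemma Beta_real_pos: "0 < \<alpha> \<Longrightarrow> 0 < \<beta> \<Longrightarrow> 0 < (Beta \<alpha> \<beta> :: real)"
  by (simp add: Beta_def Gamma_real_pos)

lemma absolutely_integrable_beta_kernel:
  assumes "0 < \<alpha>" "0 < \<beta>" "0 \<le> s" "t \<le> 1"
  shows "beta_kernel \<alpha> \<beta> absolutely_integrable_on {s<..<t}"
proof -
  have "beta_kernel \<alpha> \<beta> absolutely_integrable_on {0..1}"
    using has_integral_Beta_real[OF assms(1,2)]
    by (intro nonnegative_absolutely_integrable_1) (auto simp: beta_kernel_def[abs_def])
  then show ?thesis by (rule set_integrable_subset) (use assms in auto)
qed

lemma integral_beta_kernel_split: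
  assumes "0 < \<alpha>" "0 < \<beta>" "0 < p" "p < 1"
  shows "integral {0<..<p} (beta_kernel \<alpha> \<beta>) + integral {p<..<1} (beta_kernel \<alpha> \<beta>) = Beta \<alpha> \<beta>"
proof -
  have *: "(beta_kernel \<alpha> \<beta> has_integral Beta \<alpha> \<beta>) {0..1}"
    using has_integral_Beta_real[OF assms(1,2)] by (simp add: beta_kernel_def[abs_def])
  have "integral {0..p} (beta_kernel \<alpha> \<beta>) + integral {p..1} (beta_kernel \<alpha> \<beta>) = integral {0..1} (beta_kernel \<alpha> \<beta>)"
    using assms * by (intro Henstock_Kurzweil_Integration.integral_combine) auto
  with integral_unique[OF *] show ?thesis by (simp add: integral_open_interval_real)
qed

lemma beta_cdf_reflect:
  assumes "0 < \<alpha>" "0 < \<beta>" "0 < p" "p < 1"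
  shows "beta_cdf \<alpha> \<beta> p = 1 - beta_cdf \<beta> \<alpha> (1 - p)"
proof -
  have img: "(\<lambda>x. 1 - x) ` {0<..<p} = {1 - p<..<1}"
    by (auto intro!: image_eqI[of _ _ "1 - _"])
  have "(\<lambda>x. \<bar>- 1\<bar> * beta_kernel \<beta> \<alpha> (1 - x)) absolutely_integrable_on {0<..<p} \<and>
      integral {0<..<p} (\<lambda>x. \<bar>- 1\<bar> * beta_kernel \<beta> \<alpha> (1 - x)) = integral {1 - p<..<1} (beta_kernel \<beta> \<alpha>)"
    by (subst has_absolute_integral_change_of_variables_1')
      (use assms in \<open>auto simp: img inj_on_def intro!: derivative_eq_intros absolutely_integrable_beta_kernel\<close>)
  then have "integral {0<..<p} (beta_kernel \<alpha> \<beta>) = integral {1 - p<..<1} (beta_kernel \<beta> \<alpha>)"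
    by (simp add: beta_kernel_def[abs_def] mult.commute)
  then show ?thesis
    using integral_beta_kernel_split[of \<beta> \<alpha> "1 - p"] assms Beta_real_pos[of \<beta> \<alpha>]
    by (simp add: beta_cdf_def Beta_commute[of \<alpha> \<beta>] field_simps)
qed

text \<open>
  The identity \<open>\<bar>twin'\<bar> * f \<circ> twin = f * \<rho>\<close> behind the substitution. The factor \<open>exp (n * log_kernel p x)\<close> is the same at
  both points and cancels, which is why the weight does not depend on \<open>n\<close>.
\<close>

lemma beta_kernel_twin:
  assumes p: "0 < p" "p < 1" and x: "0 < x" "x < p"
  shows "\<bar>((p - x) / (x * (1 - x))) / ((p - twin p x) / (twin p x * (1 - twin p x)))\<bar> *
      beta_kernel (p * n + a) ((1 - p) * n + b) (twin p x)
    = beta_kernel (p * n + a) ((1 - p) * n + b) x * twin_ratio p a b x"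
proof -
  let ?y = "twin p x"
  note y = twin[OF p x]
  have flux: "exp (log_flux p a b z) = z * (1 - z) * beta_kernel a b z / \<bar>z - p\<bar>"
    if "0 < z" "z < 1" "z \<noteq> p" for z
  proof -
    have "exp (ln ((z - p)\<^sup>2) / 2) = \<bar>z - p\<bar>"
      using that by (simp add: ln_sqrt[symmetric] flip: powr_half_sqrt)
    moreover have "z * (1 - z) * beta_kernel a b z = exp (a * ln z + b * ln (1 - z))"
    proof -
      have "z * (1 - z) * beta_kernel a b z = (z * z powr (a - 1)) * ((1 - z) * (1 - z) powr (b - 1))"
        by (simp add: beta_kernel_def)
      also have "\<dots> = z powr a * (1 - z) powr b" using that by (simp add: powr_mult_base)
      finally show ?thesis using that by (simp add: powr_def exp_add)
    qed
    ultimately show ?thesis by (simp add: log_flux_def exp_diff)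
  qed
  have ratio: "twin_ratio p a b x =
      (?y * (1 - ?y) * beta_kernel a b ?y / (?y - p)) / (x * (1 - x) * beta_kernel a b x / (p - x))"
    using flux[of x] flux[of ?y] x y p by (simp add: twin_ratio_def exp_diff)
  have jac: "\<bar>((p - x) / (x * (1 - x))) / ((p - ?y) / (?y * (1 - ?y)))\<bar> =
      ((p - x) / (x * (1 - x))) / ((?y - p) / (?y * (1 - ?y)))"
    using x y p by (simp add: abs_mult)
  have kernel: "beta_kernel (p * n + a) ((1 - p) * n + b) ?y = exp (n * log_kernel p x) * beta_kernel a b ?y"
    "beta_kernel (p * n + a) ((1 - p) * n + b) x = exp (n * log_kernel p x) * beta_kernel a b x"
    using x y p by (simp_all add: beta_kernel_eq_exp)
  have cancel: "u / s / (v / r) * (e * G) = e * g * (r * G / v / (s * g / u))"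
    if "g \<noteq> 0" for u v r s e g G :: real
    using that by (simp add: mult_ac)
  have "beta_kernel a b x \<noteq> 0" using x p by (simp add: beta_kernel_def)
  then show ?thesis unfolding ratio jac kernel by (rule cancel)
qed

lemma integral_beta_kernel_twin:
  fixes p n a b :: real
  defines "f \<equiv> beta_kernel (p * n + a) ((1 - p) * n + b)"
  assumes p: "0 < p" "p < 1" and pos: "0 < p * n + a" "0 < (1 - p) * n + b"
  shows "(\<lambda>x. f x * twin_ratio p a b x) absolutely_integrable_on {0<..<p}"
    and "integral {0<..<p} (\<lambda>x. f x * twin_ratio p a b x) = integral {p<..<1} f"
proof -
  let ?d = "\<lambda>x. ((p - x) / (x * (1 - x))) / ((p - twin p x) / (twin p x * (1 - twin p x)))"
  let ?I = "integral {p<..<1} f"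
  have "(\<lambda>x. \<bar>?d x\<bar> * f (twin p x)) absolutely_integrable_on {0<..<p} \<and>
      integral {0<..<p} (\<lambda>x. \<bar>?d x\<bar> * f (twin p x)) = ?I
    \<longleftrightarrow> f absolutely_integrable_on twin p ` {0<..<p} \<and> integral (twin p ` {0<..<p}) f = ?I"
  proof (rule has_absolute_integral_change_of_variables_1')
    show "(twin p has_field_derivative ?d x) (at x within {0<..<p})" if "x \<in> {0<..<p}" for x
      using DERIV_twin[OF p, of x] that by (auto intro: has_field_derivative_at_within)
  qed (auto intro: inj_on_twin p)
  moreover have "f absolutely_integrable_on twin p ` {0<..<p} \<and> integral (twin p ` {0<..<p}) f = ?I"
    unfolding twin_image[OF p] f_def using p pos by (auto intro: absolutely_integrable_beta_kernel)
  ultimately have *: "(\<lambda>x. \<bar>?d x\<bar> * f (twin p x)) absolutely_integrable_on {0<..<p}"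
    "integral {0<..<p} (\<lambda>x. \<bar>?d x\<bar> * f (twin p x)) = ?I" by blast+
  have eq: "\<bar>?d x\<bar> * f (twin p x) = f x * twin_ratio p a b x" if "x \<in> {0<..<p}" for x
    unfolding f_def using beta_kernel_twin[OF p] that by auto
  show "(\<lambda>x. f x * twin_ratio p a b x) absolutely_integrable_on {0<..<p}"
    by (subst set_integrable_cong[OF refl refl eq[symmetric]]) (assumption, rule *(1))
  show "integral {0<..<p} (\<lambda>x. f x * twin_ratio p a b x) = integral {p<..<1} f"
    using *(2) Henstock_Kurzweil_Integration.integral_cong[of "{0<..<p}", OF eq] by simp
qed

text \<open>
  The distribution function is \<open>A / (A + B)\<close>, where \<open>B / A\<close> is the mean of \<^term>\<open>twin_ratio p a b\<close>
  on \<open>(0, p)\<close> tilted by \<^term>\<open>log_kernel p\<close>. The mean decreases to \<open>1\<close> because the ratio decreases to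
  \<open>1\<close> at \<open>p\<close>, where the tilted mass concentrates.
\<close>

lemma beta_cdf_mono_and_limit:
  assumes p: "0 < p" "p \<le> 1/2" and c: "0 \<le> (a - 1) - (a + b - 2) * p"
  defines "F \<equiv> \<lambda>n. beta_cdf (p * n + a) ((1 - p) * n + b) p"
  shows "mono_on {max (- a / p) (- b / (1 - p))<..} F" and "(F \<longlongrightarrow> 1 / 2) at_top"
proof -
  have p1: "p < 1" using p by simp
  define n0 where "n0 = max (- a / p) (- b / (1 - p))"
  have pos: "0 < p * n + a" "0 < (1 - p) * n + b" if "n > n0" for n
    using that p p1 by (auto simp: n0_def field_simps)
  define N where "N = lebesgue_on {0<..<p}"
  have space_N: "space N = {0<..<p}" by (simp add: N_def)
  have log_kernel_meas: "log_kernel p \<in> borel_measurable N"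
    unfolding N_def log_kernel_def[abs_def] by (intro measurable_restrict_space1 measurable_completion) measurable
  let ?f = "\<lambda>n. beta_kernel (p * n + a) ((1 - p) * n + b)"
  let ?g = "\<lambda>n x. exp (n * log_kernel p x) * beta_kernel a b x"
  let ?r = "twin_ratio p a b"
  define A where "A n = (\<integral>x. ?g n x \<partial>N)" for n
  define B where "B n = (\<integral>x. ?g n x * ?r x \<partial>N)" for n
  have fg: "?f n x = ?g n x" if "x \<in> space N" for n x
    using that p by (auto simp: space_N beta_kernel_eq_exp)
  have int: "integrable N (?g n)" "integrable N (\<lambda>x. ?g n x * ?r x)"
    "A n = integral {0<..<p} (?f n)" "B n = integral {p<..<1} (?f n)" if "n > n0" for n
  proof -
    have i1: "integrable N (?f n)" and i2: "integrable N (\<lambda>x. ?f n x * ?r x)"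
      using absolutely_integrable_beta_kernel[OF pos[OF that], of 0 p] p
        integral_beta_kernel_twin(1)[OF p(1) p1 pos[OF that]]
      by (auto simp: N_def integrable_restrict_space set_integrable_def)
    show "integrable N (?g n)" "integrable N (\<lambda>x. ?g n x * ?r x)"
      using i1 i2 by (simp_all add: fg cong: Bochner_Integration.integrable_cong)
    have "A n = (\<integral>x. ?f n x \<partial>N)" "B n = (\<integral>x. ?f n x * ?r x \<partial>N)"
      unfolding A_def B_def by (simp_all add: fg cong: Bochner_Integration.integral_cong)
    then show "A n = integral {0<..<p} (?f n)" "B n = integral {p<..<1} (?f n)"
      using lebesgue_integral_eq_integral[OF i1[unfolded N_def]] lebesgue_integral_eq_integral[OF i2[unfolded N_def]]
        integral_beta_kernel_twin(2)[OF p(1) p1 pos[OF that]]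
      by (simp_all add: N_def)
  qed
  have F: "F n = A n / (A n + B n)" "0 < A n + B n" if "n > n0" for n
    using integral_beta_kernel_split[OF pos[OF that] p(1) p1] Beta_real_pos[OF pos[OF that]] int(3,4)[OF that]
    by (simp_all add: F_def beta_cdf_def)
  have antimono: "?r y \<le> ?r x" if "0 < x" "x \<le> y" "y < p" for x y
    using twin_ratio_antimono[OF p(1) p1 p(2) c that] .
  have le_iff: "x \<le> y" if "log_kernel p x \<le> log_kernel p y" "0 < y" "x < p" for x y
    using log_kernel_less_left[OF p(1) p1, of y x] that by force

  show "mono_on {max (- a / p) (- b / (1 - p))<..} F"
    unfolding n0_def[symmetric]
  proof (rule mono_onI)
    fix n m assume nm: "n \<in> {n0<..}" "m \<in> {n0<..}" "n \<le> m"
    have "A n * B m \<le> A m * B n"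
      unfolding A_def B_def
      using nm by (intro exponential_tilt_ratio_mono) (auto intro: int antimono le_iff simp: space_N)
    then have "A n / (A n + B n) \<le> A m / (A m + B m)"
      using nm F(2)[of n] F(2)[of m] by (simp add: divide_simps) (simp add: algebra_simps)
    then show "F n \<le> F m" using nm F(1) by simp
  qed

  \<comment> \<open>A decreasing function on \<open>(0, p)\<close> is bounded below by its limit at \<open>p\<close>.\<close>
  have r_ge: "1 \<le> ?r x" if x: "0 < x" "x < p" for x
  proof (rule tendsto_upperbound[OF twin_ratio_tendsto[OF p(1) p1]])
    show "\<forall>\<^sub>F y in at_left p. ?r y \<le> ?r x"
      using eventually_at_left_real[OF x(2)] by eventually_elim (use x in \<open>auto intro: antimono\<close>)
  qed auto
  have conc: "\<exists>s t. s < t \<and> (\<forall>x\<in>space N. s < log_kernel p x \<longrightarrow> ?r x \<le> 1 + e) \<and>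
      0 < emeasure N {x \<in> space N. t \<le> log_kernel p x}" if "0 < e" for e
  proof -
    from that have "\<forall>\<^sub>F x in at_left p. ?r x < 1 + e"
      by (intro order_tendstoD(2)[OF twin_ratio_tendsto[OF p(1) p1]]) simp
    then obtain x where x: "x < p" "\<And>y. x < y \<Longrightarrow> y < p \<Longrightarrow> ?r y < 1 + e"
      using p(1) by (auto simp: eventually_at_left)
    \<comment> \<open>The bound \<open>p / 2\<close> only keeps \<open>s\<close> positive; \<open>x\<close> itself may lie outside \<open>(0, p)\<close>.\<close>
    define s where "s = max x (p / 2)"
    define t where "t = (s + p) / 2"
    have st: "0 < s" "s < t" "t < p" "x \<le> s" using x p by (auto simp: s_def t_def less_max_iff_disj)
    have "0 < emeasure N {t..<p}"
      unfolding N_def using st by (subst emeasure_restrict_space) auto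
    also have "{t..<p} \<subseteq> {x \<in> space N. log_kernel p t \<le> log_kernel p x}"
      using st log_kernel_less_left[OF p(1) p1, of t] by (force simp: space_N le_less)
    then have "emeasure N {t..<p} \<le> emeasure N {x \<in> space N. log_kernel p t \<le> log_kernel p x}"
      by (rule emeasure_mono) (rule borel_measurable_le[OF borel_measurable_const log_kernel_meas])
    finally have "0 < emeasure N {x \<in> space N. log_kernel p t \<le> log_kernel p x}" .
    moreover have "log_kernel p s < log_kernel p t"
      using log_kernel_less_left[OF p(1) p1, of s t] st by simp
    moreover have "\<forall>y\<in>space N. log_kernel p s < log_kernel p y \<longrightarrow> ?r y \<le> 1 + e"
    proof (intro ballI impI)
      fix y assume y: "y \<in> space N" "log_kernel p s < log_kernel p y"
      have "s < y" using log_kernel_less_left[OF p(1) p1, of y s] y st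
        by (cases s y rule: linorder_cases) (auto simp: space_N)
      then show "?r y \<le> 1 + e" using x(2)[of y] y st by (auto simp: space_N intro: less_imp_le)
    qed
    ultimately show ?thesis by blast
  qed
  have g_pos: "0 < beta_kernel a b x" if "x \<in> space N" for x
    using that p by (simp add: space_N beta_kernel_def)
  have r_ge_N: "1 \<le> ?r x" if "x \<in> space N" for x using that r_ge by (simp add: space_N)
  have lim: "((\<lambda>n. B n / A n) \<longlongrightarrow> 1) at_top"
    unfolding A_def B_def
    by (rule exponential_tilt_ratio_tendsto[OF int(1,2) log_kernel_meas g_pos r_ge_N conc])
  have A_pos: "0 < A n" if "n > n0" for n
  proof -
    have "0 < emeasure N (space N)"
      unfolding N_def using p by (simp add: emeasure_restrict_space)
    then have "0 < (\<integral>x. indicator (space N) x * ?g n x \<partial>N)"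
      using int(1)[OF that] g_pos by (intro integral_indicator_pos) auto
    also have "\<dots> = A n"
      unfolding A_def by (rule Bochner_Integration.integral_cong) auto
    finally show ?thesis .
  qed
  have "((\<lambda>n. 1 / (1 + B n / A n)) \<longlongrightarrow> 1 / (1 + 1)) at_top"
    by (intro tendsto_intros lim) simp
  moreover have "\<forall>\<^sub>F n in at_top. 1 / (1 + B n / A n) = F n"
    using eventually_gt_at_top[of n0]
  proof eventually_elim
    case (elim n)
    then show ?case using A_pos[OF elim] F(1)[OF elim] by (simp add: divide_simps)
  qed
  ultimately show "(F \<longlongrightarrow> 1 / 2) at_top" by (simp add: Lim_transform_eventually)
qed

lemma distributed_beta_cdf:
  assumes D: "distributed M lborel X (\<lambda>x. ennreal (beta_density \<alpha> \<beta> x))"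
    and pos: "0 < \<alpha>" "0 < \<beta>" and p: "0 < p" "p < 1"
  shows "measure M {\<omega> \<in> space M. X \<omega> \<le> p} = beta_cdf \<alpha> \<beta> p"
proof -
  have ai: "(beta_kernel \<alpha> \<beta> has_integral integral {0<..<p} (beta_kernel \<alpha> \<beta>)) {0<..<p}"
    using absolutely_integrable_beta_kernel[OF pos, of 0 p] p
    by (intro integrable_integral set_lebesgue_integral_eq_integral(1)) auto
  have hi: "((\<lambda>x. beta_kernel \<alpha> \<beta> x / Beta \<alpha> \<beta>) has_integral beta_cdf \<alpha> \<beta> p) {0<..<p}"
    unfolding beta_cdf_def by (rule has_integral_divide[OF ai])
  have "emeasure M {\<omega> \<in> space M. X \<omega> \<le> p} = emeasure M (X -` {..p} \<inter> space M)"
    by (rule arg_cong[of _ _ "emeasure M"]) auto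
  also have "\<dots> = (\<integral>\<^sup>+x. ennreal (beta_density \<alpha> \<beta> x) * indicator {..p} x \<partial>lborel)"
    by (rule distributed_emeasure[OF D]) simp
  also have "\<dots> = (\<integral>\<^sup>+x. ennreal (indicator {0<..<p} x * (beta_kernel \<alpha> \<beta> x / Beta \<alpha> \<beta>)) \<partial>lborel)"
    \<comment> \<open>The integrands differ only at \<open>x = p\<close>.\<close>
    using p AE_lborel_singleton[of p]
    by (intro nn_integral_cong_AE)
      (auto elim!: eventually_mono simp: beta_density_def beta_kernel_def indicator_def)
  also have "\<dots> = ennreal (beta_cdf \<alpha> \<beta> p)"
    using Beta_real_pos[OF pos] hi by (intro nn_integral_has_integral_lebesgue) auto
  finally show ?thesis
    using has_integral_nonneg[OF hi] Beta_real_pos[OF pos] by (simp add: measure_def)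
qed

theorem theorem3:
  fixes p a b :: real
    and M :: "real \<Rightarrow> 'a measure"
    and W :: "real \<Rightarrow> 'a \<Rightarrow> real"
  assumes p: "0 < p" "p < 1"
    and prob_space: "\<And>n. n > - a / p \<Longrightarrow> n > - b / (1 - p) \<Longrightarrow> prob_space (M n)"
    and distr: "\<And>n. n > - a / p \<Longrightarrow> n > - b / (1 - p) \<Longrightarrow>
      distributed (M n) lborel (W n)
        (\<lambda>x. ennreal (beta_density (p * n + a) ((1 - p) * n + b) x))"
    and cond:
      "(p \<le> 1 / 2 \<and>
          ((a \<ge> 1 \<and> 1 \<ge> b) \<or>
           (a + b \<noteq> 2 \<and> (a + b - 2) * ((a - 1) / (a + b - 2) - p) > 0)))
       \<or>
       (p \<ge> 1 / 2 \<and>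
          ((b \<ge> 1 \<and> 1 \<ge> a) \<or>
           (a + b \<noteq> 2 \<and> (a + b - 2) * ((a - 1) / (a + b - 2) - p) < 0)))"
  defines "P \<equiv> \<lambda>n. measure (M n) {\<omega> \<in> space (M n). W n \<omega> \<le> p}"
  shows "(mono_on {max (- a / p) (- b / (1 - p)) <..} P \<or>
          antimono_on {max (- a / p) (- b / (1 - p)) <..} P) \<and>
         (P \<longlongrightarrow> 1 / 2) at_top"
proof -
  define n0 where "n0 = max (- a / p) (- b / (1 - p))"
  have pos: "0 < p * n + a" "0 < (1 - p) * n + b" if "n > n0" for n
    using that p by (auto simp: n0_def field_simps)
  have P: "P n = beta_cdf (p * n + a) ((1 - p) * n + b) p" if "n > n0" for n
    unfolding P_def using that distr[of n] pos[OF that] p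
    by (intro distributed_beta_cdf) (auto simp: n0_def)
  have ev: "\<forall>\<^sub>F n in at_top. n > n0" by (rule eventually_gt_at_top)
  \<comment> \<open>The first alternatives of the two conditions fix the sign of the right-hand side here, the second
     alternatives are the sign of the left-hand side itself.\<close>
  have slope: "(a - 1) - (a + b - 2) * p = (1 - p) * (a - 1) + p * (1 - b)" by (simp add: algebra_simps)
  have quot: "(a + b - 2) * ((a - 1) / (a + b - 2) - p) = (a - 1) - (a + b - 2) * p" if "a + b \<noteq> 2"
  proof -
    have "a + b - 2 \<noteq> 0" using that by simp
    then show ?thesis by (subst right_diff_distrib) simp
  qed
  consider "p \<le> 1 / 2" "0 \<le> (a - 1) - (a + b - 2) * p" | "1 / 2 \<le> p" "(a - 1) - (a + b - 2) * p \<le> 0"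
  proof -
    have "0 \<le> (a - 1) - (a + b - 2) * p" if "a \<ge> 1" "1 \<ge> b" using that p by (simp add: slope)
    moreover have "(a - 1) - (a + b - 2) * p \<le> 0" if "b \<ge> 1" "1 \<ge> a"
      using that p unfolding slope by (intro add_nonpos_nonpos mult_nonneg_nonpos) auto
    ultimately show thesis using cond quot that by fastforce
  qed
  then show ?thesis
  proof cases
    case 1
    note F = beta_cdf_mono_and_limit[OF p(1) 1]
    have "mono_on {n0<..} P"
      using F(1)[folded n0_def] by (simp add: monotone_on_def P)
    moreover have "(P \<longlongrightarrow> 1 / 2) at_top"
      by (rule Lim_transform_eventually[OF F(2)]) (use ev in eventually_elim, simp add: P)
    ultimately show ?thesis by (simp add: n0_def)
  next
    case 2
    define F where "F n = beta_cdf ((1 - p) * n + b) (p * n + a) (1 - p)" for n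
    have n0: "n0 = max (- b / (1 - p)) (- a / p)" by (simp add: n0_def max.commute)
    have F: "mono_on {n0<..} F" "(F \<longlongrightarrow> 1 / 2) at_top"
      using beta_cdf_mono_and_limit[of "1 - p" b a] 2 p
      by (simp_all add: F_def[abs_def] n0 algebra_simps)
    have PF: "P n = 1 - F n" if "n > n0" for n
      using P[OF that] beta_cdf_reflect[OF pos[OF that] p] by (simp add: F_def)
    have "antimono_on {n0<..} P"
      using F(1) by (auto simp: monotone_on_def PF)
    moreover have "((\<lambda>n. 1 - F n) \<longlongrightarrow> 1 - 1 / 2) at_top" by (intro tendsto_intros F)
    then have "(P \<longlongrightarrow> 1 - 1 / 2) at_top"
      by (rule Lim_transform_eventually) (use ev in eventually_elim, simp add: PF)
    ultimately show ?thesis by (simp add: n0_def)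
  qed
qed

end
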